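(* Let $1\le n\le\omega$. Then there exists a zero-dimensional scattered separable metrizable space that is $n$-homogeneous but not $\ell$-homogeneous for any $\ell<n$ (where $\ell\geq 1$).
   Context: The base theory is $\mathsf{ZF}+\mathsf{DC}$. All spaces are separable and metrizable. A space is zero-dimensional if it has a base of clopen sets. A space $X$ is homogeneous if for every $(x,y)\in X\times X$ there is a homeomorphism $h:X\to X$ with $h(x)=y$. Given $n$ such that $1\le n\le\omega$, a space $X$ is $n$-homogeneous if $X=\bigcup_{k\in n}X_k$ (where $n=\{k:k<n\}$), with each $X_k$ a homogeneous subspace of $X$. The Cantor-Bendixson derivatives of $X$ are defined by: $X^{(0)}=X$; $X^{(\xi+1)}=X^{(\xi)}\setminus\{x\in X^{(\xi)}:x\text{ is isolated in }X^{(\xi)}\}$; $X^{(\xi)}=\bigcap_{\xi'<\xi}X^{(\xi')}$ for limit ordinals $\xi$. A space $X$ is scattered if $X^{(\xi)}=\varnothing$ for some ordinal $\xi$. *)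

theory Defs
  imports "HOL-Analysis.Analysis" "HOL-Library.Extended_Nat"
begin

definition zero_dimensional :: "'a topology \<Rightarrow> bool" where
  "zero_dimensional X \<longleftrightarrow>
     (\<exists>\<B>. (\<forall>V\<in>\<B>. openin X V \<and> closedin X V) \<and>
          (\<forall>U x. openin X U \<and> x \<in> U \<longrightarrow> (\<exists>V\<in>\<B>. x \<in> V \<and> V \<subseteq> U)))"

definition homogeneous :: "'a topology \<Rightarrow> bool" where
  "homogeneous X \<longleftrightarrow>
     (\<forall>x\<in>topspace X. \<forall>y\<in>topspace X. \<exists>h. homeomorphic_map X X h \<and> h x = y)"

text \<open>Here \<open>\<infinity>\<close> plays the role of \<open>\<omega>\<close>. The pieces are neither required to be
  disjoint nor to be nonempty.\<close>

definition n_homogeneous :: "enat \<Rightarrow> 'a topology \<Rightarrow> bool" where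
  "n_homogeneous n X \<longleftrightarrow>
     (\<exists>P :: nat \<Rightarrow> 'a set. topspace X = (\<Union>k\<in>{k. enat k < n}. P k) \<and>
        (\<forall>k. enat k < n \<longrightarrow> homogeneous (subtopology X (P k))))"

definition cb_step :: "'a topology \<Rightarrow> 'a set \<Rightarrow> 'a set" where
  "cb_step X A = A - {x \<in> A. openin (subtopology X A) {x}}"

text \<open>An ordinal is represented by an element \<open>\<xi>\<close> of the field of a well-order \<open>r\<close>; it is the
  order type of the set \<open>underS r \<xi>\<close> of strict predecessors of \<open>\<xi>\<close>. It is the successor
  of \<open>\<eta>\<close> iff these strict predecessors are exactly the elements of \<open>under r \<eta>\<close>, that is,
  the elements below or equal to \<open>\<eta>\<close>.\<close>

definition cb_derivative :: "'a topology \<Rightarrow> 'o rel \<Rightarrow> 'o \<Rightarrow> 'a set" where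
  "cb_derivative X r = wo_rel.worec r (\<lambda>D \<xi>.
     if underS r \<xi> = {} then topspace X
     else if \<exists>\<eta>\<in>Field r. underS r \<xi> = under r \<eta>
       then cb_step X (D (THE \<eta>. \<eta> \<in> Field r \<and> underS r \<xi> = under r \<eta>))
     else (\<Inter>\<eta>\<in>underS r \<xi>. D \<eta>))"

text \<open>An existential quantifier over all ordinals is not available in HOL, but well-orders with
  field in \<^typ>\<open>'a set\<close> provide enough of them: the map taking \<open>\<xi>\<close> to its derivative is
  injective up to the first \<open>\<xi>\<close> with empty derivative. Lemma \<open>scatteredI\<close> below shows that
  well-orders on other types would not make more spaces scattered.\<close>

definition scattered :: "'a topology \<Rightarrow> bool" where
  "scattered X \<longleftrightarrow>
     (\<exists>(r :: 'a set rel) \<xi>. Well_order r \<and> \<xi> \<in> Field r \<and> cb_derivative X r \<xi> = {})"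

lemma under_eq_imp_eq:
  assumes "Well_order r" "\<eta> \<in> Field r" "\<eta>' \<in> Field r" "under r \<eta> = under r \<eta>'"
  shows "\<eta> = \<eta>'"
proof -
  interpret wo_rel r using assms(1) by (simp add: wo_rel_def)
  have "\<eta> \<in> under \<eta>'" "\<eta>' \<in> under \<eta>"
    using assms(2-4) REFL by (auto simp: under_def refl_on_def)
  then show ?thesis
    using ANTISYM by (auto simp: under_def antisym_def)
qed

lemma cb_derivative_unfold:
  assumes "Well_order r"
  shows "cb_derivative X r \<xi> =
    (if underS r \<xi> = {} then topspace X
     else if \<exists>\<eta>\<in>Field r. underS r \<xi> = under r \<eta>
       then cb_step X (cb_derivative X r (THE \<eta>. \<eta> \<in> Field r \<and> underS r \<xi> = under r \<eta>))
     else (\<Inter>\<eta>\<in>underS r \<xi>. cb_derivative X r \<eta>))"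
proof -
  interpret wo_rel r using assms by (simp add: wo_rel_def)
  let ?H = "\<lambda>D \<xi>. if underS \<xi> = {} then topspace X
     else if \<exists>\<eta>\<in>Field r. underS \<xi> = under \<eta>
       then cb_step X (D (THE \<eta>. \<eta> \<in> Field r \<and> underS \<xi> = under \<eta>))
     else (\<Inter>\<eta>\<in>underS \<xi>. D \<eta>)"
  have "adm_wo ?H"
    unfolding adm_wo_def
  proof (intro allI impI)
    fix f g :: "'a \<Rightarrow> 'b set" and x
    assume eq: "\<forall>y\<in>underS x. f y = g y"
    have "f (THE \<eta>. \<eta> \<in> Field r \<and> underS x = under \<eta>) = g (THE \<eta>. \<eta> \<in> Field r \<and> underS x = under \<eta>)"
      if \<eta>: "\<eta> \<in> Field r" "underS x = under \<eta>" for \<eta>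
    proof -
      have "(THE \<eta>. \<eta> \<in> Field r \<and> underS x = under \<eta>) = \<eta>"
        using \<eta> under_eq_imp_eq[OF assms] by (intro the_equality) auto
      moreover have "\<eta> \<in> underS x"
        using \<eta> REFL by (auto simp: under_def refl_on_def)
      ultimately show ?thesis using eq by simp
    qed
    then show "?H f x = ?H g x" using eq by auto
  qed
  from worec_fixpoint[OF this] show ?thesis
    unfolding cb_derivative_def by (rule fun_cong)
qed

lemma cb_derivative_zero:
  assumes "Well_order r" "underS r \<xi> = {}"
  shows "cb_derivative X r \<xi> = topspace X"
  using cb_derivative_unfold[OF assms(1), of X \<xi>] assms(2) by simp

lemma cb_derivative_succ:
  assumes "Well_order r" "\<eta> \<in> Field r" "underS r \<xi> = under r \<eta>"
  shows "cb_derivative X r \<xi> = cb_step X (cb_derivative X r \<eta>)"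
proof -
  interpret wo_rel r using assms(1) by (simp add: wo_rel_def)
  have "(THE \<eta>. \<eta> \<in> Field r \<and> underS \<xi> = under \<eta>) = \<eta>"
    using assms(2,3) under_eq_imp_eq[OF assms(1)] by (intro the_equality) auto
  moreover have "\<eta> \<in> underS \<xi>"
    using assms(2,3) REFL by (auto simp: under_def refl_on_def)
  ultimately show ?thesis
    using cb_derivative_unfold[OF assms(1), of X \<xi>] assms(2,3) by auto
qed

lemma cb_derivative_limit:
  assumes "Well_order r" "underS r \<xi> \<noteq> {}" "\<not> (\<exists>\<eta>\<in>Field r. underS r \<xi> = under r \<eta>)"
  shows "cb_derivative X r \<xi> = (\<Inter>\<eta>\<in>underS r \<xi>. cb_derivative X r \<eta>)"
  using cb_derivative_unfold[OF assms(1), of X \<xi>] assms(2,3) by simp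

lemma cb_step_subset: "cb_step X A \<subseteq> A"
  by (auto simp: cb_step_def)

lemma cb_derivative_Inter_steps:
  assumes wo: "Well_order r"
  shows "cb_derivative X r \<xi> = topspace X \<inter> (\<Inter>\<eta>\<in>underS r \<xi>. cb_step X (cb_derivative X r \<eta>))"
proof -
  interpret wo_rel r using wo by (simp add: wo_rel_def)
  let ?D = "cb_derivative X r"
  show ?thesis
  proof (induction \<xi> rule: well_order_induct)
    case (1 \<xi>)
    have IH: "?D \<eta> = topspace X \<inter> (\<Inter>\<zeta>\<in>underS \<eta>. cb_step X (?D \<zeta>))" if "\<eta> \<in> underS \<xi>" for \<eta>
      using 1 that by (auto simp: underS_def)
    have top: "?D \<eta> \<subseteq> topspace X" if "\<eta> \<in> underS \<xi>" for \<eta>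
      using IH[OF that] by blast
    have dec: "?D \<eta> \<subseteq> cb_step X (?D \<zeta>)" if "\<eta> \<in> underS \<xi>" "\<zeta> \<in> underS \<eta>" for \<eta> \<zeta>
      using IH[OF that(1)] that(2) by blast
    consider "underS \<xi> = {}" | \<eta> where "\<eta> \<in> Field r" "underS \<xi> = under \<eta>"
      | "underS \<xi> \<noteq> {}" "\<not> (\<exists>\<eta>\<in>Field r. underS \<xi> = under \<eta>)" by blast
    then show ?case
    proof cases
      case 1
      then show ?thesis using cb_derivative_zero[OF wo] by simp
    next
      case (2 \<eta>)
      have \<eta>: "\<eta> \<in> underS \<xi>" using 2 REFL by (auto simp: under_def refl_on_def)
      have "cb_step X (?D \<eta>) \<subseteq> cb_step X (?D \<zeta>)" if "\<zeta> \<in> underS \<xi>" for \<zeta>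
      proof (cases "\<zeta> = \<eta>")
        case False
        then have "\<zeta> \<in> underS \<eta>" using that 2(2) by (auto simp: underS_def under_def)
        then have "?D \<eta> \<subseteq> cb_step X (?D \<zeta>)" by (rule dec[OF \<eta>])
        then show ?thesis by (rule order_trans[OF cb_step_subset])
      qed simp
      then have "(\<Inter>\<zeta>\<in>underS \<xi>. cb_step X (?D \<zeta>)) = cb_step X (?D \<eta>)"
        using \<eta> by blast
      moreover have "cb_step X (?D \<eta>) \<subseteq> topspace X"
        by (rule order_trans[OF cb_step_subset top[OF \<eta>]])
      ultimately show ?thesis
        using cb_derivative_succ[OF wo 2, of X] by (simp add: Int_absorb1)
    next
      case 3
      have "\<exists>\<zeta>. \<zeta> \<in> underS \<xi> \<and> \<eta> \<in> underS \<zeta>" if "\<eta> \<in> underS \<xi>" for \<eta>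
      proof -
        have \<eta>: "\<eta> \<in> Field r" "(\<eta>, \<xi>) \<in> r" "\<eta> \<noteq> \<xi>"
          using that by (auto simp: underS_def Field_def)
        have "under \<eta> \<subseteq> underS \<xi>"
          using \<eta> TRANS ANTISYM unfolding under_def underS_def trans_def antisym_def by blast
        then obtain \<zeta> where \<zeta>: "\<zeta> \<in> underS \<xi>" "\<zeta> \<notin> under \<eta>" using 3(2) \<eta>(1) by blast
        then have "\<zeta> \<in> Field r" by (auto simp: underS_def Field_def)
        then have "\<eta> \<in> underS \<zeta>"
          using TOTALS \<eta>(1) \<zeta>(2) REFL by (auto simp: under_def underS_def refl_on_def)
        then show ?thesis using \<zeta> by blast
      qed
      then have "(\<Inter>\<eta>\<in>underS \<xi>. ?D \<eta>) \<subseteq> (\<Inter>\<eta>\<in>underS \<xi>. cb_step X (?D \<eta>))"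
        using dec by (intro INT_greatest) (meson INT_lower order_trans)
      moreover have "(\<Inter>\<eta>\<in>underS \<xi>. cb_step X (?D \<eta>)) \<subseteq> (\<Inter>\<eta>\<in>underS \<xi>. ?D \<eta>)"
        by (intro INT_greatest) (meson INT_lower order_trans cb_step_subset)
      moreover have "(\<Inter>\<eta>\<in>underS \<xi>. ?D \<eta>) \<subseteq> topspace X" using top 3(1) by blast
      ultimately have "topspace X \<inter> (\<Inter>\<eta>\<in>underS \<xi>. cb_step X (?D \<eta>)) = (\<Inter>\<eta>\<in>underS \<xi>. ?D \<eta>)"
        by (simp add: subset_antisym Int_absorb1)
      then show ?thesis using cb_derivative_limit[OF wo 3, of X] by simp
    qed
  qed
qed

lemma scatteredI:
  fixes r :: "'o rel"
  assumes wo: "Well_order r" and "\<xi> \<in> Field r" "cb_derivative X r \<xi> = {}"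
  shows "scattered X"
proof -
  interpret wo_rel r using wo by (simp add: wo_rel_def)
  let ?D = "cb_derivative X r"
  note D = cb_derivative_Inter_steps[OF wo, of X]
  have D_top: "?D \<zeta> \<subseteq> topspace X" for \<zeta>
    by (subst D) (rule Int_lower1)
  have D_step: "?D \<zeta> \<subseteq> cb_step X (?D \<eta>)" if "\<eta> \<in> underS \<zeta>" for \<eta> \<zeta>
    by (subst D) (use that in blast)
  have D_greatest: "A \<subseteq> ?D \<zeta>"
    if "A \<subseteq> topspace X" "\<And>\<eta>. \<eta> \<in> underS \<zeta> \<Longrightarrow> A \<subseteq> cb_step X (?D \<eta>)" for A \<zeta>
    by (subst D) (use that in blast)
  obtain \<xi>0 where \<xi>0: "\<xi>0 \<in> Field r" "?D \<xi>0 = {}"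
    and min: "\<And>\<eta>. \<eta> \<in> underS \<xi>0 \<Longrightarrow> ?D \<eta> \<noteq> {}"
  proof -
    define Q where "Q = {\<xi> \<in> Field r. ?D \<xi> = {}}"
    have "\<xi> \<in> Q" using assms(2,3) by (simp add: Q_def)
    with WF have "\<exists>z\<in>Q. \<forall>y. (y, z) \<in> r - Id \<longrightarrow> y \<notin> Q"
      unfolding wf_eq_minimal by (elim allE) (erule mp, blast)
    then obtain z where "z \<in> Q" and least: "\<And>y. (y, z) \<in> r - Id \<Longrightarrow> y \<notin> Q"
      by (elim bexE) simp
    then have z: "z \<in> Field r" "?D z = {}" by (simp_all add: Q_def)
    have "?D \<eta> \<noteq> {}" if "\<eta> \<in> underS z" for \<eta>
    proof -
      have "(\<eta>, z) \<in> r - Id" "\<eta> \<in> Field r" using that by (auto simp: underS_def Field_def)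
      then show ?thesis using least by (simp add: Q_def)
    qed
    then show ?thesis by (rule that[OF z])
  qed
  define S where "S = under \<xi>0"
  have S: "S \<subseteq> Field r" by (auto simp: S_def under_def Field_def)
  have down: "\<eta> \<in> S" if "(\<eta>, \<zeta>) \<in> r" "\<zeta> \<in> S" for \<eta> \<zeta>
    using that TRANS by (auto simp: S_def under_def trans_def)
  have psub: "?D \<zeta> \<noteq> ?D \<eta>" if \<eta>: "\<eta> \<in> underS \<zeta>" "\<zeta> \<in> S" for \<eta> \<zeta>
  proof
    assume eq: "?D \<zeta> = ?D \<eta>"
    have "?D \<eta> \<subseteq> cb_step X (?D \<eta>)" using D_step[OF \<eta>(1)] eq by simp
    then have fix_step: "cb_step X (?D \<eta>) = ?D \<eta>" by (rule equalityI[OF cb_step_subset])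
    have const: "?D \<eta> \<subseteq> ?D \<theta>" for \<theta>
    proof (induction \<theta> rule: well_order_induct)
      case (1 \<theta>)
      have "?D \<eta> \<subseteq> cb_step X (?D \<kappa>)" if \<kappa>: "\<kappa> \<in> underS \<theta>" for \<kappa>
      proof (cases "\<kappa> \<in> underS \<eta>")
        case True
        then show ?thesis by (rule D_step)
      next
        case False
        have "\<kappa> \<in> Field r" "\<eta> \<in> Field r"
          using \<kappa> \<eta>(1) by (auto simp: underS_def Field_def)
        then have "(\<eta>, \<kappa>) \<in> r" using False TOTALS REFL by (auto simp: underS_def refl_on_def)
        then have "\<kappa> = \<eta> \<or> \<eta> \<in> underS \<kappa>" by (auto simp: underS_def)
        then have "?D \<kappa> \<subseteq> ?D \<eta>" using order_trans[OF D_step cb_step_subset] by blast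
        moreover have "?D \<eta> \<subseteq> ?D \<kappa>" using 1 \<kappa> by (auto simp: underS_def)
        ultimately show ?thesis using fix_step by simp
      qed
      with D_top show ?case by (rule D_greatest)
    qed
    have "\<eta> \<in> underS \<xi>0"
      using \<eta> TRANS ANTISYM unfolding S_def under_def underS_def trans_def antisym_def by blast
    then show False using min const[of \<xi>0] \<xi>0(2) by blast
  qed
  have inj: "inj_on ?D S"
  proof (rule inj_onI)
    fix a b assume ab: "a \<in> S" "b \<in> S" "?D a = ?D b"
    then have "(a, b) \<in> r \<or> (b, a) \<in> r" using S TOTALS by blast
    then have "a = b \<or> a \<in> underS b \<or> b \<in> underS a" by (auto simp: underS_def)
    then show "a = b" using psub[of a b] psub[of b a] ab by auto
  qed
  have wS: "Well_order (Restr r S)" using wo by (rule Well_order_Restr)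
  have FS: "Field (Restr r S) = S"
    using S REFL by (auto simp: Field_def refl_on_def)
  define r' where "r' = dir_image (Restr r S) ?D"
  have wo': "Well_order r'"
    unfolding r'_def using wS inj FS by (intro Well_order_dir_image) auto
  have F': "Field r' = ?D ` S" by (simp add: r'_def dir_image_Field FS)
  have under': "Order_Relation.underS r' (?D \<theta>) = ?D ` underS \<theta>" if "\<theta> \<in> S" for \<theta>
  proof
    show "Order_Relation.underS r' (?D \<theta>) \<subseteq> ?D ` underS \<theta>"
      using that inj by (auto simp: underS_def r'_def dir_image_def inj_on_def)
    show "?D ` underS \<theta> \<subseteq> Order_Relation.underS r' (?D \<theta>)"
    proof
      fix A assume "A \<in> ?D ` underS \<theta>"
      then obtain \<kappa> where \<kappa>: "\<kappa> \<in> underS \<theta>" "A = ?D \<kappa>" by blast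
      then have "(\<kappa>, \<theta>) \<in> Restr r S" using that down by (auto simp: underS_def)
      then have "(?D \<kappa>, ?D \<theta>) \<in> r'" by (auto simp: r'_def dir_image_def)
      then show "A \<in> Order_Relation.underS r' (?D \<theta>)" using \<kappa> psub[OF \<kappa>(1) that] by (simp add: underS_def)
    qed
  qed
  have copy: "\<theta> \<in> S \<longrightarrow> cb_derivative X r' (?D \<theta>) = ?D \<theta>" for \<theta>
  proof (induction \<theta> rule: well_order_induct)
    case (1 \<theta>)
    show ?case
    proof
      assume \<theta>: "\<theta> \<in> S"
      have "cb_derivative X r' (?D \<kappa>) = ?D \<kappa>" if "\<kappa> \<in> underS \<theta>" for \<kappa>
        using 1 that down \<theta> by (auto simp: underS_def)
      then show "cb_derivative X r' (?D \<theta>) = ?D \<theta>"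
        using cb_derivative_Inter_steps[OF wo', of X "?D \<theta>"] D[of \<theta>] under'[OF \<theta>] by simp
    qed
  qed
  have "\<xi>0 \<in> S" using \<xi>0(1) REFL by (auto simp: S_def under_def refl_on_def)
  then have "?D \<xi>0 \<in> Field r'"
    unfolding F' by (rule imageI)
  moreover have "cb_derivative X r' (?D \<xi>0) = {}"
    using copy[of \<xi>0] \<open>\<xi>0 \<in> S\<close> \<xi>0(2) by simp
  ultimately show ?thesis using wo' unfolding scattered_def by blast
qed

end

theory Submission
  imports Defs
begin

text \<open>
  The example is a countable set of reals whose Cantor-Bendixson rank is tuned to \<open>n\<close>; being
  countable, it is separable and zero-dimensional.

  In any space the level \<open>X\<^sup>(\<^sup>k\<^sup>) - X\<^sup>(\<^sup>k\<^sup>+\<^sup>1\<^sup>)\<close> consists of isolated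
  points of \<open>X\<^sup>(\<^sup>k\<^sup>)\<close>, so it is discrete and hence homogeneous. If every point lies in a
  level \<open>k < n\<close>, the levels witness that the space is \<open>n\<close>-homogeneous
  (\<open>n_homogeneous_if_levels\<close>).

  Conversely, let the finite derivatives of \<open>X\<close> have empty intersection. Every nonempty subspace
  then has an isolated point, and homogeneity makes all of its points isolated: homogeneous
  subspaces are discrete (\<open>homogeneous_subspace_discrete\<close>). Moreover, \<open>l\<close> discrete subspaces
  cannot cover a point that survives \<open>l\<close> derivatives. Indeed, if such a point \<open>x\<close> belongs to the
  discrete set \<open>P i\<close>, then some neighbourhood of \<open>x\<close> meets \<open>P i\<close> in \<open>x\<close> alone, so this
  neighbourhood without \<open>x\<close> is covered by the other \<open>l - 1\<close> sets although it contains points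
  surviving \<open>l - 1\<close> derivatives; induction finishes the argument
  (\<open>union_of_discrete_derivative_empty\<close>). So an \<open>l\<close>-homogeneous \<open>X\<close> has empty \<open>l\<close>-th
  derivative.

  It remains to find a set whose \<open>l\<close>-th derivative is nonempty for each \<open>l < n\<close> while every
  point disappears at some stage \<open>k + 1\<close> with \<open>k < n\<close>. The set \<open>tower k\<close>, a copy of the ordinal
  \<open>\<omega>\<^sup>k + 1\<close>, has \<open>k\<close>-th derivative \<open>{0}\<close>; the disjoint sum of the sets \<open>tower k\<close> over all
  \<open>k < n\<close> does what is needed for finite and infinite \<open>n\<close> alike.
\<close>

section \<open>Finite Cantor-Bendixson derivatives\<close>

definition finite_derivative :: "'a topology \<Rightarrow> nat \<Rightarrow> 'a set" where
  "finite_derivative X k = (cb_step X ^^ k) (topspace X)"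

lemma finite_derivative_0 [simp]: "finite_derivative X 0 = topspace X"
  by (simp add: finite_derivative_def)

lemma finite_derivative_Suc [simp]:
  "finite_derivative X (Suc k) = cb_step X (finite_derivative X k)"
  by (simp add: finite_derivative_def)

lemma finite_derivative_antimono:
  "j \<le> k \<Longrightarrow> finite_derivative X k \<subseteq> finite_derivative X j"
  by (induction k rule: dec_induct) (use cb_step_subset in force)+

lemma finite_derivative_subset_topspace: "finite_derivative X k \<subseteq> topspace X"
  using finite_derivative_antimono[of 0 k X] by simp

lemma in_cb_step_iff:
  "x \<in> cb_step X A \<longleftrightarrow> x \<in> A \<and> (\<forall>U. openin X U \<and> x \<in> U \<longrightarrow> (\<exists>y\<in>U \<inter> A. y \<noteq> x))"
proof -
  have "openin (subtopology X A) {x} \<longleftrightarrow> (\<exists>U. openin X U \<and> x \<in> U \<and> \<not> (\<exists>y\<in>U \<inter> A. y \<noteq> x))"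
    if "x \<in> A"
    unfolding openin_subtopology using that by (auto intro!: arg_cong[where f = Ex])
  then show ?thesis by (auto simp: cb_step_def)
qed

lemma cb_step_singleton: "a \<in> topspace X \<Longrightarrow> cb_step X {a} = {}"
  by (auto simp: in_cb_step_iff)

lemma isolated_pointE:
  assumes "x \<in> A" "x \<notin> cb_step X A"
  obtains U where "openin X U" "U \<inter> A = {x}"
  using assms unfolding in_cb_step_iff by blast

lemma cb_step_open_subset:
  assumes "openin X U"
  shows "cb_step X A \<inter> U = cb_step (subtopology X U) (A \<inter> U)"
proof (rule set_eqI)
  fix x
  have "(\<exists>y\<in>V \<inter> A. y \<noteq> x)"
    if "\<forall>W. openin (subtopology X U) W \<and> x \<in> W \<longrightarrow> (\<exists>y\<in>W \<inter> (A \<inter> U). y \<noteq> x)"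
       "openin X V" "x \<in> V" "x \<in> U" for V
    using that(1)[rule_format, of "V \<inter> U"] that(2-) by (auto simp: openin_subtopology)
  moreover have "(\<exists>y\<in>W \<inter> (A \<inter> U). y \<noteq> x)"
    if "\<forall>V. openin X V \<and> x \<in> V \<longrightarrow> (\<exists>y\<in>V \<inter> A. y \<noteq> x)"
       "openin (subtopology X U) W" "x \<in> W" for W
    using that assms by (auto simp: openin_open_subtopology)
  ultimately show "x \<in> cb_step X A \<inter> U \<longleftrightarrow> x \<in> cb_step (subtopology X U) (A \<inter> U)"
    unfolding in_cb_step_iff Int_iff by meson
qed

text \<open>Being isolated is a local property, so derivatives may be computed inside an open piece. This
  reduces the derivatives of the example to those of its separated building blocks.\<close>

lemma finite_derivative_open_subset:
  "openin X U \<Longrightarrow> finite_derivative X k \<inter> U = finite_derivative (subtopology X U) k"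
  by (induction k) (simp_all add: topspace_subtopology cb_step_open_subset)

lemma cb_step_homeomorphic_image:
  assumes h: "homeomorphic_map X Y h" and A: "A \<subseteq> topspace X"
  shows "cb_step Y (h ` A) = h ` cb_step X A"
proof -
  have inj: "inj_on h (topspace X)"
    using h by (rule homeomorphic_imp_injective_map)
  have hA: "homeomorphic_map (subtopology X A) (subtopology Y (h ` A)) h"
  proof (intro homeomorphic_map_subtopologies[OF h])
    have "h ` A \<subseteq> topspace Y"
      using A homeomorphic_imp_surjective_map[OF h] by blast
    then show "h ` (topspace X \<inter> A) = topspace Y \<inter> h ` A"
      using A by (simp add: Int_absorb1)
  qed
  have "openin (subtopology Y (h ` A)) {h x} \<longleftrightarrow> openin (subtopology X A) {x}" if "x \<in> A" for x
    using homeomorphic_map_openness[OF hA, of "{x}"] that A by auto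
  then show ?thesis
    using inj A by (auto simp: cb_step_def inj_on_def)
qed

lemma finite_derivative_homeomorphic_image:
  assumes h: "homeomorphic_map X Y h"
  shows "finite_derivative Y k = h ` finite_derivative X k"
proof (induction k)
  case 0
  then show ?case using homeomorphic_imp_surjective_map[OF h] by simp
next
  case (Suc k)
  then show ?case
    by (simp add: cb_step_homeomorphic_image[OF h finite_derivative_subset_topspace])
qed

text \<open>The infinite derivative in the well-order of the extended naturals is contained in every finite
  one. This order type, \<open>\<omega> + 1\<close>, also covers spaces whose points have unbounded finite ranks.\<close>

lemma scattered_if_finite_derivatives_vanish:
  assumes "(\<Inter>k. finite_derivative X k) = {}"
  shows "scattered X"
proof -
  let ?r = "{(a, b). a \<le> (b :: enat)}"
  have wo: "Well_order ?r"
  proof -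
    have "?r - Id = {(a, b). a < b}" by auto
    moreover have "Field ?r = UNIV" by (auto simp: Field_def)
    ultimately show ?thesis
      unfolding well_order_on_def linear_order_on_def partial_order_on_def preorder_on_def
      by (auto simp: refl_on_def antisym_def total_on_def wf intro: transI)
  qed
  have F: "Field ?r = UNIV" by (auto simp: Field_def)
  have fin: "cb_derivative X ?r (enat k) = finite_derivative X k" for k
  proof (induction k)
    case 0
    have "underS ?r (enat 0) = {}" by (auto simp: underS_def enat_0)
    then show ?case by (simp add: cb_derivative_zero[OF wo])
  next
    case (Suc k)
    have "underS ?r (enat (Suc k)) = under ?r (enat k)"
      by (auto simp: underS_def under_def) (metis enat_ile enat_ord_simps(1) le_Suc_eq nle_le)+
    with Suc show ?case using cb_derivative_succ[OF wo, of "enat k" "enat (Suc k)" X] F by simp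
  qed
  have "cb_derivative X ?r \<infinity> \<subseteq> finite_derivative X k" for k
  proof -
    have "enat k \<in> underS ?r \<infinity>" by (simp add: underS_def)
    then have "cb_derivative X ?r \<infinity> \<subseteq> cb_step X (cb_derivative X ?r (enat k))"
      by (subst cb_derivative_Inter_steps[OF wo]) blast
    then show ?thesis using fin[of k] cb_step_subset[of X "finite_derivative X k"] by auto
  qed
  with assms have "cb_derivative X ?r \<infinity> = {}" by blast
  then show ?thesis using scatteredI[OF wo] F by blast
qed

section \<open>Homogeneous subspaces of scattered spaces\<close>

text \<open>Every permutation of a discrete space is a homeomorphism; a transposition carries one given
  point to another.\<close>

lemma homogeneous_discrete_topology: "homogeneous (discrete_topology S)"
proof -
  have "\<exists>h. homeomorphic_map (discrete_topology S) (discrete_topology S) h \<and> h x = y"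
    if "x \<in> S" "y \<in> S" for x y
    using that
    by (intro exI[of _ "\<lambda>z. if z = x then y else if z = y then x else z"] conjI
        homeomorphic_map_involution) auto
  then show ?thesis unfolding homogeneous_def by simp
qed

lemma homogeneous_derivative_level:
  "homogeneous (subtopology X (finite_derivative X k - finite_derivative X (Suc k)))"
    (is "homogeneous (subtopology X ?L)")
proof -
  have "openin (subtopology X ?L) {x}" if x: "x \<in> ?L" for x
  proof -
    obtain U where "openin X U" "U \<inter> finite_derivative X k = {x}"
      using x by (auto elim: isolated_pointE)
    with x have "openin X U" "{x} = U \<inter> ?L" by auto
    then show ?thesis by (auto simp: openin_subtopology)
  qed
  then have "subtopology X ?L = discrete_topology ?L"
    using finite_derivative_subset_topspace[of X k] 
    by (intro sym[OF iffD2[OF discrete_topology_unique]]) auto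
  then show ?thesis by (simp add: homogeneous_discrete_topology)
qed

text \<open>At the first stage where the derivatives of \<open>X\<close> lose a point of \<open>P\<close>, that point is isolated in
  a derivative still containing all of \<open>P\<close>, hence isolated in \<open>P\<close>. A homeomorphism of \<open>P\<close> carries it
  to any other point.\<close>

lemma homogeneous_subspace_discrete:
  assumes hom: "homogeneous (subtopology X P)" and P: "P \<subseteq> topspace X"
    and vanish: "(\<Inter>k. finite_derivative X k) = {}"
    and y: "y \<in> P"
  shows "openin (subtopology X P) {y}"
proof -
  \<comment> \<open>the least such stage is a successor, because \<open>P\<close> lies in the zeroth derivative\<close>
  have ex: "\<exists>k. \<not> P \<subseteq> finite_derivative X k" using y vanish by blast
  define k where "k = (LEAST k. \<not> P \<subseteq> finite_derivative X k)"
  have k: "\<not> P \<subseteq> finite_derivative X k"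
    unfolding k_def using ex by (rule LeastI_ex)
  then obtain j where j: "k = Suc j" using P by (cases k) auto
  have sub: "P \<subseteq> finite_derivative X j"
    using not_less_Least[of j "\<lambda>k. \<not> P \<subseteq> finite_derivative X k"] j by (auto simp: k_def)
  obtain x where x: "x \<in> P" "x \<notin> finite_derivative X (Suc j)" using k j by blast
  then obtain U where "openin X U" "U \<inter> finite_derivative X j = {x}"
    using sub isolated_pointE[of x "finite_derivative X j" X] by auto
  with sub x have "openin X U" "{x} = U \<inter> P" by auto
  then have opx: "openin (subtopology X P) {x}" by (auto simp: openin_subtopology)
  have top: "topspace (subtopology X P) = P" using P by auto
  obtain h where h: "homeomorphic_map (subtopology X P) (subtopology X P) h" "h x = y"
    using hom x(1) y unfolding homogeneous_def top by blast
  then show ?thesis using homeomorphic_map_openness[OF h(1), of "{x}"] opx x(1) top by auto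
qed

text \<open>Removing a point \<open>x\<close> of \<open>P i\<close> from a neighbourhood that isolates it in \<open>P i\<close> leaves an open set
  covered by one discrete set less. By induction that set misses the previous derivative, so \<open>x\<close> is
  isolated there and does not reach the next one. The open set \<open>U\<close> is arbitrary because the
  induction passes to such punctured neighbourhoods.\<close>

lemma union_of_discrete_derivative_empty:
  assumes "t1_space X" "openin X U" "finite I" "U \<subseteq> (\<Union>i\<in>I. P i)"
    and discrete: "\<And>i x. i \<in> I \<Longrightarrow> x \<in> P i \<Longrightarrow> openin (subtopology X (P i)) {x}"
  shows "U \<inter> finite_derivative X (card I) = {}"
  using assms(3,2,4) discrete
proof (induction "card I" arbitrary: I U)
  case 0
  then show ?case by simp
next
  case (Suc n)
  show ?case
  proof (rule ccontr)
    assume "U \<inter> finite_derivative X (card I) \<noteq> {}"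
    then obtain x where x: "x \<in> U" "x \<in> cb_step X (finite_derivative X n)"
      using Suc.hyps(2)[symmetric] by auto
    then obtain i where i: "i \<in> I" "x \<in> P i" using Suc.prems by blast
    then obtain V where V: "openin X V" "V \<inter> P i = {x}"
      using Suc.prems(4) by (force simp: openin_subtopology)
    define W where "W = U \<inter> V - {x}"
    have "openin X W"
      unfolding W_def using V(1) Suc.prems(2) \<open>t1_space X\<close> x(1) openin_subset[OF Suc.prems(2)]
      by (intro openin_diff) (auto intro: closedin_t1_singleton)
    moreover have "n = card (I - {i})" using Suc.hyps(2) i(1) Suc.prems(1) by simp
    moreover have "W \<subseteq> (\<Union>i\<in>I - {i}. P i)" using Suc.prems(3) V(2) by (auto simp: W_def)
    ultimately have "W \<inter> finite_derivative X n = {}"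
      using Suc.hyps(1)[of "I - {i}" W] Suc.prems by auto
    moreover have "openin X (U \<inter> V)" "x \<in> U \<inter> V" using V Suc.prems(2) x(1) by auto
    then obtain z where "z \<in> U \<inter> V \<inter> finite_derivative X n" "z \<noteq> x"
      using x(2) unfolding in_cb_step_iff by blast
    ultimately show False unfolding W_def by blast
  qed
qed

lemma n_homogeneous_imp_finite_derivative_empty:
  assumes "t1_space X" and vanish: "(\<Inter>k. finite_derivative X k) = {}"
    and "n_homogeneous (enat l) X"
  shows "finite_derivative X l = {}"
proof -
  obtain P where P: "topspace X = (\<Union>k\<in>{k. enat k < enat l}. P k)"
    and hom: "\<And>k. k < l \<Longrightarrow> homogeneous (subtopology X (P k))"
    using assms(3) unfolding n_homogeneous_def by auto
  have top: "topspace X = (\<Union>k\<in>{..<l}. P k)" using P by auto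
  have "openin (subtopology X (P k)) {x}" if "k \<in> {..<l}" "x \<in> P k" for k x
    using that hom top vanish by (intro homogeneous_subspace_discrete) auto
  then have "topspace X \<inter> finite_derivative X (card {..<l}) = {}"
    using top
    by (intro union_of_discrete_derivative_empty[OF assms(1) openin_topspace, where P = P]) auto
  then show ?thesis using finite_derivative_subset_topspace[of X l] by auto
qed

text \<open>The homogeneous pieces are the levels of the Cantor-Bendixson filtration; each point belongs to
  the last level before the first derivative that omits it.\<close>

lemma n_homogeneous_if_levels:
  assumes "\<And>x. x \<in> topspace X \<Longrightarrow> \<exists>k. enat k < n \<and> x \<notin> finite_derivative X (Suc k)"
  shows "n_homogeneous n X"
proof -
  let ?L = "\<lambda>k. finite_derivative X k - finite_derivative X (Suc k)"
  have "topspace X = (\<Union>k\<in>{k. enat k < n}. ?L k)"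
  proof (intro equalityI subsetI)
    fix x assume x: "x \<in> topspace X"
    then obtain k where k: "enat k < n" "x \<notin> finite_derivative X (Suc k)" using assms by blast
    define j where "j = (LEAST j. x \<notin> finite_derivative X (Suc j))"
    have j: "x \<notin> finite_derivative X (Suc j)" unfolding j_def using k(2) by (rule LeastI)
    have "j \<le> k" unfolding j_def using k(2) by (rule Least_le)
    then have "enat j < n" using k(1) by (meson enat_ord_simps(1) order_le_less_trans)
    moreover have "x \<in> finite_derivative X j"
    proof (cases j)
      case (Suc i)
      then show ?thesis
        using not_less_Least[of i "\<lambda>j. x \<notin> finite_derivative X (Suc j)"]
        unfolding j_def[symmetric] by blast
    qed (use x in simp)
    ultimately show "x \<in> (\<Union>k\<in>{k. enat k < n}. ?L k)" using j by blast
  qed (auto dest: subsetD[OF finite_derivative_subset_topspace] simp del: finite_derivative_Suc)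
  then show ?thesis
    unfolding n_homogeneous_def using homogeneous_derivative_level by blast
qed

section \<open>Countable sets of reals\<close>

lemma separable_space_countable: "countable (topspace X) \<Longrightarrow> separable_space X"
  unfolding separable_space_def by (intro exI[of _ "topspace X"]) simp

text \<open>Every real interval contains a point outside \<open>S\<close>. Between two such points the open and the
  closed interval have the same trace on \<open>S\<close>, which is therefore clopen.\<close>

lemma zero_dimensional_countable_real:
  fixes S :: "real set"
  assumes "countable S"
  shows "zero_dimensional (top_of_set S)"
proof -
  let ?X = "top_of_set S"
  have gap: "\<exists>c. a < c \<and> c < b \<and> c \<notin> S" if "a < b" for a b :: real
  proof -
    have "\<not> {a<..<b} \<subseteq> S"
      using that assms uncountable_open_interval[of a b] countable_subset by blast
    then show ?thesis by auto
  qed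
  have "\<exists>V. openin ?X V \<and> closedin ?X V \<and> x \<in> V \<and> V \<subseteq> U" if U: "openin ?X U" "x \<in> U" for U x
  proof -
    obtain T where T: "open T" "U = S \<inter> T" using U(1) by (auto simp: openin_open)
    then obtain e where e: "e > 0" "ball x e \<subseteq> T" using U(2) open_contains_ball by (metis IntD2)
    obtain a where a: "x - e < a" "a < x" "a \<notin> S" using gap[of "x - e" x] e(1) by auto
    obtain b where b: "x < b" "b < x + e" "b \<notin> S" using gap[of x "x + e"] e(1) by auto
    have "openin ?X (S \<inter> {a<..<b})" by (simp add: openin_open_Int)
    moreover have "S \<inter> {a<..<b} = S \<inter> {a..b}" using a(3) b(3) by (force simp: less_le)
    then have "closedin ?X (S \<inter> {a<..<b})" by (simp add: closedin_closed_Int)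
    moreover have "{a<..<b} \<subseteq> ball x e" using a b by (auto simp: dist_real_def)
    then have "S \<inter> {a<..<b} \<subseteq> U" using T(2) e(2) by blast
    moreover have "x \<in> S \<inter> {a<..<b}" using a b U(2) T(2) by auto
    ultimately show ?thesis by blast
  qed
  then show ?thesis
    unfolding zero_dimensional_def
    by (intro exI[of _ "{V. openin ?X V \<and> closedin ?X V}"]) auto
qed

lemma homeomorphic_map_affine:
  fixes A :: "real set"
  assumes "c \<noteq> 0"
  shows "homeomorphic_map (top_of_set A) (top_of_set ((\<lambda>x. c * x + d) ` A)) (\<lambda>x. c * x + d)"
proof -
  have "homeomorphic_maps (top_of_set A) (top_of_set ((\<lambda>x. c * x + d) ` A))
      (\<lambda>x. c * x + d) (\<lambda>y. (y - d) / c)"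
    unfolding homeomorphic_maps_def using assms by (auto intro!: continuous_intros)
  then show ?thesis using homeomorphic_map_maps by blast
qed

lemma finite_derivative_affine_piece:
  fixes S A J :: "real set"
  assumes "c \<noteq> 0" "open J" "S \<inter> J = (\<lambda>x. c * x + d) ` A"
  shows "finite_derivative (top_of_set S) k \<inter> J =
    (\<lambda>x. c * x + d) ` finite_derivative (top_of_set A) k"
proof -
  have "finite_derivative (top_of_set S) k \<inter> J = finite_derivative (top_of_set S) k \<inter> (S \<inter> J)"
    using finite_derivative_subset_topspace[of "top_of_set S" k] by auto
  also have "\<dots> = finite_derivative (subtopology (top_of_set S) (S \<inter> J)) k"
    using assms(2) by (intro finite_derivative_open_subset) (simp add: openin_open_Int)
  also have "subtopology (top_of_set S) (S \<inter> J) = top_of_set ((\<lambda>x. c * x + d) ` A)"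
    unfolding assms(3)[symmetric] by (simp add: subtopology_subtopology)
  also have "finite_derivative \<dots> k = (\<lambda>x. c * x + d) ` finite_derivative (top_of_set A) k"
    using homeomorphic_map_affine[OF assms(1)] by (rule finite_derivative_homeomorphic_image)
  finally show ?thesis .
qed

section \<open>Sets of reals of prescribed Cantor-Bendixson rank\<close>

text \<open>A subset of \<open>[0,1]\<close> homeomorphic to the ordinal \<open>\<omega>\<^sup>k + 1\<close>: the next tower is a
  sequence of scaled copies of the previous one converging to \<open>0\<close>. The copy with ratio
  \<open>c = 4\<^sup>-\<^sup>(\<^sup>m\<^sup>+\<^sup>1\<^sup>)\<close> lies in \<open>[c, 2c]\<close>. The base \<open>4\<close> keeps these intervals apart, whereas with
  base \<open>2\<close> neighbouring ones would touch.\<close>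

primrec tower :: "nat \<Rightarrow> real set" where
  "tower 0 = {0}"
| "tower (Suc k) = insert 0 (\<Union>m. (\<lambda>x. (1/4)^Suc m * x + (1/4)^Suc m) ` tower k)"

lemma countable_tower: "countable (tower k)"
  by (induction k) auto

lemma zero_in_tower [simp]: "0 \<in> tower k"
  by (cases k) auto

lemma tower_bounds: "tower k \<subseteq> {0..1}"
proof (induction k)
  case (Suc k)
  have "(1/4)^Suc m * x + (1/4)^Suc m \<in> {0..1::real}" if "x \<in> tower k" for x m
  proof -
    have x: "0 \<le> x" "x \<le> 1" using that Suc by auto
    have "(1/4)^Suc m \<le> (1/4::real)" using power_le_one[of "1/4::real" m] by simp
    moreover have "(1/4)^Suc m * x \<le> (1/4::real)^Suc m" using x by (intro mult_left_le) auto
    moreover have "0 \<le> (1/4)^Suc m * x" using x by simp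
    ultimately show ?thesis unfolding atLeastAtMost_iff by linarith
  qed
  then show ?case by auto
qed simp

text \<open>Since the next copies on either side lie in \<open>[c/4, c/2]\<close> and \<open>[4c, 8c]\<close>, the displayed open
  interval cuts out exactly one copy.\<close>

lemma tower_Suc_piece:
  fixes m :: nat
  defines "c \<equiv> (1/4::real)^Suc m"
  shows "tower (Suc k) \<inter> {c/2<..<4*c} = (\<lambda>x. c * x + c) ` tower k"
proof -
  have c: "c > 0" by (simp add: c_def)
  show ?thesis
  proof (intro equalityI subsetI)
    fix y assume "y \<in> (\<lambda>x. c * x + c) ` tower k"
    then obtain x where x: "x \<in> tower k" "y = c * x + c" by blast
    then have "0 \<le> x" "x \<le> 1" using tower_bounds[of k] by auto
    then have "0 \<le> c * x" "c * x \<le> c" using c by (auto intro: mult_left_le)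
    then have "y \<in> {c/2<..<4*c}"
      unfolding x(2) greaterThanLessThan_iff using c by linarith
    moreover have "y \<in> tower (Suc k)"
      unfolding x(2) c_def tower.simps using x(1) by blast
    ultimately show "y \<in> tower (Suc k) \<inter> {c/2<..<4*c}" by blast
  next
    fix y assume y: "y \<in> tower (Suc k) \<inter> {c/2<..<4*c}"
    then have "y \<noteq> 0" using c by auto
    then obtain i x where x: "x \<in> tower k" "y = (1/4)^Suc i * x + (1/4)^Suc i"
      using y unfolding tower.simps by blast
    let ?c = "(1/4::real)^Suc i"
    have "0 \<le> x" "x \<le> 1" using x(1) tower_bounds[of k] by auto
    then have "0 \<le> ?c * x" "?c * x \<le> ?c" by (simp, intro mult_left_le) simp_all
    then have b: "?c \<le> y" "y \<le> 2 * ?c" unfolding x(2) by linarith+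
    have cy: "c / 2 < y" "y < 4 * c" using y by auto
    have "\<not> i < m"
    proof
      assume "i < m"
      then have "(1/4::real)^m \<le> (1/4)^Suc i" by (intro power_decreasing) auto
      moreover have "(1/4::real)^m = 4 * c" by (simp add: c_def)
      ultimately show False using b cy by linarith
    qed
    moreover have "\<not> m < i"
    proof
      assume "m < i"
      then have "(1/4::real)^i \<le> (1/4)^Suc m" by (intro power_decreasing) auto
      moreover have "(1/4::real)^i = 4 * ?c" "(1/4::real)^Suc m = c" by (simp_all add: c_def)
      ultimately show False using b cy by linarith
    qed
    ultimately have "i = m" by simp
    then show "y \<in> (\<lambda>x. c * x + c) ` tower k" unfolding c_def using x by blast
  qed
qed

text \<open>By induction, the \<open>k\<close>-th derivative of \<open>tower (Suc k)\<close> contains just the base point \<open>c m\<close> of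
  each copy, together with \<open>0\<close>. The base points are isolated in it and vanish at the next stage,
  while \<open>0\<close> survives as their limit.\<close>

lemma finite_derivative_tower: "finite_derivative (top_of_set (tower k)) k = {0}"
proof (induction k)
  case 0
  then show ?case by simp
next
  case (Suc k)
  let ?X = "top_of_set (tower (Suc k))"
  define c where "c m = (1/4::real)^Suc m" for m
  have c: "c m > 0" for m by (simp add: c_def)
  have piece: "finite_derivative ?X j \<inter> {c m/2<..<4*c m} =
      (\<lambda>x. c m * x + c m) ` finite_derivative (top_of_set (tower k)) j" for j m
    using tower_Suc_piece[of k m] c[of m]
    by (intro finite_derivative_affine_piece) (simp_all add: c_def)
  have "0 \<in> finite_derivative ?X j" if "j \<le> Suc k" for j
    using that
  proof (induction j)
    case (Suc j)
    have "\<exists>y\<in>U \<inter> finite_derivative ?X j. y \<noteq> 0" if U: "openin ?X U" "0 \<in> U" for U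
    proof -
      obtain T where T: "open T" "U = tower (Suc k) \<inter> T" using U(1) by (auto simp: openin_open)
      \<comment> \<open>the base points of the copies witness that \<open>0\<close> is not isolated\<close>
      have "c \<longlonglongrightarrow> 0"
        unfolding c_def by (rule LIMSEQ_Suc) (simp add: LIMSEQ_power_zero)
      then have "eventually (\<lambda>m. c m \<in> T) sequentially"
        using T U(2) by (auto simp: tendsto_def)
      then obtain m where m: "c m \<in> T" by (auto simp: eventually_sequentially)
      have "c m \<in> finite_derivative ?X k"
        using piece[of k m] by (auto simp: \<open>finite_derivative (top_of_set (tower k)) k = {0}\<close>)
      then have "c m \<in> finite_derivative ?X j"
        using finite_derivative_antimono[of j k ?X] Suc.prems by auto
      moreover from this have "c m \<in> U"
        using m T(2) finite_derivative_subset_topspace[of ?X j] by auto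
      ultimately show ?thesis using c[of m] by (intro bexI[of _ "c m"]) auto
    qed
    then show ?case using Suc by (simp add: in_cb_step_iff)
  qed (simp only: finite_derivative_0 topspace_euclidean_subtopology zero_in_tower)
  moreover have "x = 0" if x: "x \<in> finite_derivative ?X (Suc k)" for x
  proof (rule ccontr)
    assume "x \<noteq> 0"
    moreover have "x \<in> tower (Suc k)" using x finite_derivative_subset_topspace[of ?X "Suc k"] by auto
    ultimately obtain m where "x \<in> (\<lambda>x. c m * x + c m) ` tower k" by (auto simp: c_def)
    then have "x \<in> {c m/2<..<4*c m}" using tower_Suc_piece[of k m] unfolding c_def by blast
    then have "finite_derivative (top_of_set (tower k)) (Suc k) \<noteq> {}" using x piece by blast
    then show False using Suc.IH by (simp add: cb_step_singleton)
  qed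
  ultimately show ?case by blast
qed

text \<open>The disjoint sum of the towers of height below \<open>n\<close>, realized by placing \<open>tower k\<close> in
  \<open>[2k, 2k + 1]\<close>.\<close>

definition tower_row :: "enat \<Rightarrow> real set" where
  "tower_row n = (\<Union>k\<in>{k. enat k < n}. (\<lambda>x. x + 2 * real k) ` tower k)"

lemma countable_tower_row: "countable (tower_row n)"
  unfolding tower_row_def using countable_tower by (intro countable_UN) auto

lemma finite_derivative_tower_row:
  assumes "enat k < n"
  shows "finite_derivative (top_of_set (tower_row n)) j \<inter> {2 * real k - 1/2<..<2 * real k + 3/2} =
    (\<lambda>x. x + 2 * real k) ` finite_derivative (top_of_set (tower k)) j"
proof -
  let ?J = "{2 * real k - 1/2<..<2 * real k + 3/2}"
  have "tower_row n \<inter> ?J = (\<lambda>x. 1 * x + 2 * real k) ` tower k"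
  proof (intro equalityI subsetI)
    fix y assume y: "y \<in> tower_row n \<inter> ?J"
    then obtain i x where x: "x \<in> tower i" "y = x + 2 * real i" by (auto simp: tower_row_def)
    then have "0 \<le> x" "x \<le> 1" using tower_bounds[of i] by auto
    then have "real i < real k + 1" "real k < real i + 1" using x(2) y by auto
    then have "i = k" by linarith
    then show "y \<in> (\<lambda>x. 1 * x + 2 * real k) ` tower k" using x by auto
  next
    fix y assume "y \<in> (\<lambda>x. 1 * x + 2 * real k) ` tower k"
    then show "y \<in> tower_row n \<inter> ?J"
      using assms tower_bounds[of k] by (fastforce simp: tower_row_def)
  qed
  from finite_derivative_affine_piece[OF _ _ this] show ?thesis by simp
qed

text \<open>The tower containing a point bounds its rank. For \<open>n = \<infinity>\<close> no single stage serves all points,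
  so the bound depends on the point.\<close>

lemma tower_row_rank_bound:
  assumes "x \<in> tower_row n"
  obtains k where "enat k < n" "x \<notin> finite_derivative (top_of_set (tower_row n)) (Suc k)"
proof -
  obtain k y where k: "enat k < n" "y \<in> tower k" "x = y + 2 * real k"
    using assms by (auto simp: tower_row_def)
  then have "x \<in> {2 * real k - 1/2<..<2 * real k + 3/2}" using tower_bounds[of k] by auto
  moreover have "finite_derivative (top_of_set (tower k)) (Suc k) = {}"
    by (simp add: finite_derivative_tower cb_step_singleton)
  ultimately have "x \<notin> finite_derivative (top_of_set (tower_row n)) (Suc k)"
    using finite_derivative_tower_row[OF k(1), of "Suc k"] by auto
  with k(1) that show ?thesis by blast
qed

theorem corollary7p2:
  fixes n :: enat
  assumes "1 \<le> n"
  shows "\<exists>X :: real topology.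
    separable_space X \<and> metrizable_space X \<and> zero_dimensional X \<and> scattered X \<and>
    n_homogeneous n X \<and>
    (\<forall>l :: enat. 1 \<le> l \<and> l < n \<longrightarrow> \<not> n_homogeneous l X)"
proof -
  let ?X = "top_of_set (tower_row n)"
  have vanish: "(\<Inter>k. finite_derivative ?X k) = {}"
  proof -
    have "x \<notin> (\<Inter>k. finite_derivative ?X k)" if x: "x \<in> tower_row n" for x
    proof -
      obtain k where "x \<notin> finite_derivative ?X (Suc k)"
        using tower_row_rank_bound[OF x] by metis
      then show ?thesis by (intro notI) (drule INT_D[of _ _ _ "Suc k"], simp_all)
    qed
    moreover have "(\<Inter>k. finite_derivative ?X k) \<subseteq> tower_row n"
      using INT_lower[of 0 UNIV "finite_derivative ?X"] by simp
    ultimately show ?thesis by blast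
  qed
  have metrizable: "metrizable_space ?X"
    by (intro metrizable_space_subtopology metrizable_space_euclidean)
  have "\<not> n_homogeneous l ?X" if "l < n" for l
  proof -
    obtain k where k: "l = enat k" using \<open>l < n\<close> by (cases l) auto
    \<comment> \<open>the apex of \<open>tower k\<close> survives \<open>k\<close> derivatives, so \<open>k\<close> homogeneous pieces are too few\<close>
    have "2 * real k \<in> finite_derivative ?X k"
      using finite_derivative_tower_row[of k n k] that k by (auto simp: finite_derivative_tower)
    then show ?thesis
      using n_homogeneous_imp_finite_derivative_empty[OF metrizable_imp_t1_space[OF metrizable] vanish]
      unfolding k by blast
  qed
  moreover have "n_homogeneous n ?X"
  proof (rule n_homogeneous_if_levels)
    fix x assume "x \<in> topspace ?X"
    then have "x \<in> tower_row n" by simp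
    then show "\<exists>k. enat k < n \<and> x \<notin> finite_derivative ?X (Suc k)"
      by (rule tower_row_rank_bound) (intro exI conjI)
  qed
  ultimately show ?thesis
    using metrizable separable_space_countable[of ?X] zero_dimensional_countable_real
      countable_tower_row[of n] scattered_if_finite_derivatives_vanish[OF vanish]
    by (intro exI[of _ ?X]) simp
qed

end
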